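(* For every integer $n\ge2$ there is a graph isomorphism \[ L\{(x,y)\in\mathbb{Z}^2\,;\,x\ge y\ge x-(n-1)\}\cong(P_n\times_K\mathbb{Z})^o, \] where the right-hand side stands for the connected component of $P_n\times_K\mathbb{Z}$ containing $o=(0,0)$, $P_n$ being the path on $\{0,1,\dots,n-1\}$. Similarly, there is a graph isomorphism \[ L\{(x,y)\in\mathbb{Z}^2\,;\,x\ge y\}\cong(\mathbb{Z}_+\times_K\mathbb{Z})^o, \] where the right-hand side is the connected component of $\mathbb{Z}_+\times_K\mathbb{Z}$ containing $o=(0,0)$.
   Context: Graphs are undirected, without loops or multiple edges. $\mathbb{Z}$, $\mathbb{Z}_+=\{0,1,2,\dots\}$ and $P_n$ (with vertex set $\{0,1,\dots,n-1\}$) are regarded as graphs in which two integers are adjacent if and only if they differ by exactly $1$. The Kronecker product $G_1\times_K G_2$ of graphs $G_1=(V_1,E_1)$ and $G_2=(V_2,E_2)$ is the graph on $V_1\times V_2$ with $(x,y)\sim(x',y')$ if and only if $x\sim x'$ in $G_1$ and $y\sim y'$ in $G_2$. The 2-dimensional integer lattice $\mathbb{Z}\times_C\mathbb{Z}$ is the graph on $\mathbb{Z}^2$ in which $(x,y)\sim(x',y')$ if and only if either $x'=x\pm1$ and $y'=y$, or $x'=x$ and $y'=y\pm1$. For $D\subset\mathbb{Z}^2$, $L[D]$ (also written $LD$ when $D$ is given in set-builder notation) denotes the induced subgraph of $\mathbb{Z}\times_C\mathbb{Z}$ spanned by the vertices in $D$. *)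

theory Defs
  imports "Graph_Theory.Digraph_Isomorphism"
begin

text \<open>
  As in \<^theory>\<open>Graph_Theory.Digraph\<close>, an undirected graph is a symmetric digraph: the edge
  between \<open>u\<close> and \<open>v\<close> is the pair of arcs \<open>(u, v)\<close> and \<open>(v, u)\<close>, and vertices are adjacent
  iff \<open>u \<rightarrow>\<^bsub>G\<^esub> v\<close>. Since arcs are pairs of vertices, there are no multiple edges. The locale
  \<open>graph\<close> is not used because it requires finiteness.
\<close>

definition simple_graph :: "('a, 'b) pre_digraph \<Rightarrow> bool" where
  "simple_graph G \<longleftrightarrow> sym_digraph G \<and> loopfree_digraph G \<and> nomulti_digraph G"

definition adj_graph :: "'a set \<Rightarrow> ('a \<Rightarrow> 'a \<Rightarrow> bool) \<Rightarrow> ('a, 'a \<times> 'a) pre_digraph" where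
  "adj_graph V R = with_proj \<lparr>pverts = V, parcs = {(u, v). u \<in> V \<and> v \<in> V \<and> R u v}\<rparr>"

definition int_set_graph :: "int set \<Rightarrow> (int, int \<times> int) pre_digraph" where
  "int_set_graph S = adj_graph S (\<lambda>x y. \<bar>x - y\<bar> = 1)"

definition int_graph :: "(int, int \<times> int) pre_digraph" where
  "int_graph = int_set_graph UNIV"

definition nonneg_graph :: "(int, int \<times> int) pre_digraph" where
  "nonneg_graph = int_set_graph {0..}"

definition path_graph :: "int \<Rightarrow> (int, int \<times> int) pre_digraph" where
  "path_graph n = int_set_graph {0..n - 1}"

definition kronecker_product ::
    "('a, 'b) pre_digraph \<Rightarrow> ('c, 'd) pre_digraph \<Rightarrow> ('a \<times> 'c, ('a \<times> 'c) \<times> ('a \<times> 'c)) pre_digraph"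
    (infixr \<open>\<times>\<^sub>K\<close> 70) where
  "G \<times>\<^sub>K H = adj_graph (verts G \<times> verts H) (\<lambda>(x, y) (x', y'). x \<rightarrow>\<^bsub>G\<^esub> x' \<and> y \<rightarrow>\<^bsub>H\<^esub> y')"

definition square_lattice :: "(int \<times> int, (int \<times> int) \<times> (int \<times> int)) pre_digraph" where
  "square_lattice = adj_graph UNIV (\<lambda>(x, y) (x', y').
     (x' = x + 1 \<or> x' = x - 1) \<and> y' = y \<or> x' = x \<and> (y' = y + 1 \<or> y' = y - 1))"

definition L :: "(int \<times> int) set \<Rightarrow> (int \<times> int, (int \<times> int) \<times> (int \<times> int)) pre_digraph" where
  "L D = square_lattice \<restriction> D"

text \<open>
  In a symmetric digraph the strongly connected component of a vertex is its connected component.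
\<close>

definition component :: "('a, 'b) pre_digraph \<Rightarrow> 'a \<Rightarrow> ('a, 'b) pre_digraph" where
  "component G v = G \<restriction> pre_digraph.scc_of G v"

lemma adj_graph_simps [simp]:
  "verts (adj_graph V R) = V"
  "arcs (adj_graph V R) = {(u, v). u \<in> V \<and> v \<in> V \<and> R u v}"
  "tail (adj_graph V R) = fst"
  "head (adj_graph V R) = snd"
  "u \<rightarrow>\<^bsub>adj_graph V R\<^esub> v \<longleftrightarrow> u \<in> V \<and> v \<in> V \<and> R u v"
  by (simp_all add: adj_graph_def)

lemma simple_graph_adj_graph:
  assumes "symp R" and "irreflp R"
  shows "simple_graph (adj_graph V R)"
  unfolding simple_graph_def
proof (intro conjI)
  show "sym_digraph (adj_graph V R)"
    using assms(1) by unfold_locales (auto simp: symmetric_conv dest: sympD)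
  show "loopfree_digraph (adj_graph V R)"
    using assms(2) by unfold_locales (auto dest: irreflpD)
  show "nomulti_digraph (adj_graph V R)"
    by unfold_locales (auto simp: arc_to_ends_def)
qed

lemma simple_graph_int_set_graph: "simple_graph (int_set_graph S)"
  unfolding int_set_graph_def
  by (rule simple_graph_adj_graph) (auto intro!: sympI irreflpI)

lemma simple_graph_square_lattice: "simple_graph square_lattice"
  unfolding square_lattice_def
  by (rule simple_graph_adj_graph) (auto intro!: sympI irreflpI)

lemma simple_graph_kronecker_product:
  assumes "simple_graph G" and "simple_graph H"
  shows "simple_graph (G \<times>\<^sub>K H)"
proof -
  interpret G: sym_digraph G using assms(1) by (simp add: simple_graph_def)
  interpret G: loopfree_digraph G using assms(1) by (simp add: simple_graph_def)
  interpret H: sym_digraph H using assms(2) by (simp add: simple_graph_def)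
  show ?thesis
    unfolding kronecker_product_def
    by (rule simple_graph_adj_graph)
      (auto intro!: sympI irreflpI dest: G.graph_symmetric H.graph_symmetric G.adj_not_same)
qed

lemma component_in_sccs:
  assumes "simple_graph G" and "v \<in> verts G"
  shows "component G v \<in> pre_digraph.sccs G" and "v \<in> verts (component G v)"
    and "verts (component G v) = {u. v \<rightarrow>\<^sup>*\<^bsub>G\<^esub> u}"
proof -
  interpret sym_digraph G using assms(1) by (simp add: simple_graph_def)
  show "component G v \<in> sccs"
    unfolding component_def
    using assms(2) by (simp add: in_sccs_verts_conv[symmetric] scc_of_in_sccs_verts)
  show "v \<in> verts (component G v)"
    using assms(2) by (simp add: component_def in_scc_of_self)
  show "verts (component G v) = {u. v \<rightarrow>\<^sup>*\<^bsub>G\<^esub> u}"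
    unfolding component_def scc_of_def induce_subgraph_verts by (blast dest: symmetric_reachable')
qed

text \<open>
  When arcs are pairs of vertices, \<^const>\<open>digraph_iso\<close> is the usual notion of graph isomorphism.
\<close>

lemma digraph_iso_iff_bij:
  fixes G :: "('a, 'a \<times> 'a) pre_digraph" and H :: "('b, 'b \<times> 'b) pre_digraph"
  assumes "wf_digraph G" "tail G = fst" "head G = snd"
    and "wf_digraph H" "tail H = fst" "head H = snd"
  shows "digraph_iso G H \<longleftrightarrow> (\<exists>f. bij_betw f (verts G) (verts H) \<and>
    (\<forall>u\<in>verts G. \<forall>v\<in>verts G. u \<rightarrow>\<^bsub>G\<^esub> v \<longleftrightarrow> f u \<rightarrow>\<^bsub>H\<^esub> f v))"
proof -
  have arcs: "x \<rightarrow>\<^bsub>G\<^esub> y \<longleftrightarrow> (x, y) \<in> arcs G" "x' \<rightarrow>\<^bsub>H\<^esub> y' \<longleftrightarrow> (x', y') \<in> arcs H" for x y x' y'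
    by (auto simp: arcs_ends_conv assms)
  have endsG: "fst e \<in> verts G" "snd e \<in> verts G" if "e \<in> arcs G" for e
    using wf_digraph.tail_in_verts[OF assms(1) that] wf_digraph.head_in_verts[OF assms(1) that]
    by (simp_all add: assms)
  have endsH: "fst e \<in> verts H" "snd e \<in> verts H" if "e \<in> arcs H" for e
    using wf_digraph.tail_in_verts[OF assms(4) that] wf_digraph.head_in_verts[OF assms(4) that]
    by (simp_all add: assms)
  show ?thesis
  proof
    assume "digraph_iso G H"
    then obtain h where iso: "pre_digraph.digraph_isomorphism G h" and H: "H = app_iso h G"
      by (auto simp: digraph_iso_def)
    let ?f = "iso_verts h"
    have inj: "inj_on ?f (verts G)"
      and ends: "\<And>a. a \<in> arcs G \<Longrightarrow> ?f (fst a) = iso_tail h (iso_arcs h a) \<and> ?f (snd a) = iso_head h (iso_arcs h a)"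
      using iso by (auto simp: pre_digraph.digraph_isomorphism_def assms)
    have h: "verts H = ?f ` verts G" "arcs H = iso_arcs h ` arcs G" "iso_tail h = fst" "iso_head h = snd"
      using assms(5,6) by (simp_all add: H)
    have im: "iso_arcs h a = (?f (fst a), ?f (snd a))" if "a \<in> arcs G" for a
      using ends[OF that] by (simp add: h prod_eq_iff)
    have "u \<rightarrow>\<^bsub>G\<^esub> v \<longleftrightarrow> ?f u \<rightarrow>\<^bsub>H\<^esub> ?f v" if "u \<in> verts G" "v \<in> verts G" for u v
    proof
      assume "u \<rightarrow>\<^bsub>G\<^esub> v"
      then show "?f u \<rightarrow>\<^bsub>H\<^esub> ?f v"
        using im[of "(u, v)"] by (force simp: arcs h)
    next
      assume "?f u \<rightarrow>\<^bsub>H\<^esub> ?f v"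
      then obtain e where e: "e \<in> arcs G" "(?f u, ?f v) = iso_arcs h e"
        by (auto simp: arcs h)
      then have "fst e = u" "snd e = v"
        using im[OF e(1)] endsG[OF e(1)] that inj by (auto dest: inj_onD)
      with e show "u \<rightarrow>\<^bsub>G\<^esub> v" by (auto simp: arcs)
    qed
    then show "\<exists>f. bij_betw f (verts G) (verts H) \<and>
        (\<forall>u\<in>verts G. \<forall>v\<in>verts G. u \<rightarrow>\<^bsub>G\<^esub> v \<longleftrightarrow> f u \<rightarrow>\<^bsub>H\<^esub> f v)"
      using inj h(1) by (auto simp: bij_betw_def intro!: exI[of _ ?f])
  next
    assume "\<exists>f. bij_betw f (verts G) (verts H) \<and>
        (\<forall>u\<in>verts G. \<forall>v\<in>verts G. u \<rightarrow>\<^bsub>G\<^esub> v \<longleftrightarrow> f u \<rightarrow>\<^bsub>H\<^esub> f v)"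
    then obtain f where inj: "inj_on f (verts G)" and vH: "verts H = f ` verts G"
      and adj: "\<And>u v. u \<in> verts G \<Longrightarrow> v \<in> verts G \<Longrightarrow> (u, v) \<in> arcs G \<longleftrightarrow> (f u, f v) \<in> arcs H"
      by (auto simp: bij_betw_def arcs)
    define h where "h = \<lparr>iso_verts = f, iso_arcs = map_prod f f,
      iso_head = (snd :: 'b \<times> 'b \<Rightarrow> 'b), iso_tail = fst\<rparr>"
    have "inj_on (map_prod f f) (arcs G)"
      by (rule inj_on_subset[OF map_prod_inj_on[OF inj inj]])
        (simp add: subset_iff mem_Times_iff endsG del: split_paired_All)
    then have "pre_digraph.digraph_isomorphism G h"
      using inj assms(1) by (simp add: pre_digraph.digraph_isomorphism_def h_def assms)
    moreover have "arcs H = map_prod f f ` arcs G"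
    proof (intro equalityI subsetI)
      fix e assume e: "e \<in> arcs H"
      then obtain u v where "u \<in> verts G" "v \<in> verts G" "fst e = f u" "snd e = f v"
        using endsH[OF e] by (auto simp: vH)
      then have "(u, v) \<in> arcs G" "e = map_prod f f (u, v)"
        using e adj by (metis prod.collapse, simp add: prod_eq_iff)
      then show "e \<in> map_prod f f ` arcs G"
        by (rule rev_image_eqI)
    next
      fix e assume "e \<in> map_prod f f ` arcs G"
      then obtain u v where "(u, v) \<in> arcs G" "e = (f u, f v)"
        by auto
      then show "e \<in> arcs H"
        using endsG[of "(u, v)"] adj by simp
    qed
    then have "H = app_iso h G"
      by (intro pre_digraph.equality) (simp_all add: h_def vH assms)
    ultimately show "digraph_iso G H"
      by (auto simp: digraph_iso_def)
  qed
qed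

end

theory Submission
  imports Defs
begin

text \<open>
  The isomorphism is the rotation of the lattice by 45 degrees, \<open>(x, y) \<mapsto> (x - y, x + y)\<close>. A unit
  step in either coordinate of \<open>(x, y)\<close> changes both \<open>x - y\<close> and \<open>x + y\<close> by exactly 1, and every
  such simultaneous change comes from exactly one unit step; so lattice adjacency becomes Kronecker
  adjacency. The image of the plane consists of the pairs \<open>(a, b)\<close> with \<open>a + b\<close> even, and the
  constraint on the region \<open>D\<close> only concerns \<open>a = x - y\<close>: it says \<open>a \<in> S\<close>, where \<open>S\<close> is the vertex
  set of the left factor.

  It remains to see that the component of the origin in the Kronecker product is precisely the
  even part. The parity of \<open>a + b\<close> is invariant along edges (\<open>even_if_reachable\<close>). Conversely, one
  moves along the column \<open>a = 0\<close> in steps of 2 by zigzagging between \<open>a = 0\<close> and \<open>a = 1\<close>, and then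
  diagonally away from that column (\<open>reachable_if_even\<close>). The zigzag is where the strip needs
  width at least 2. Both parts of the theorem are the instances \<open>S = {0..n - 1}\<close> and \<open>S = {0..}\<close>
  of one statement about initial segments \<open>S\<close> of the nonnegative integers.
\<close>

lemma adj_induce_subgraph_iff:
  "u \<rightarrow>\<^bsub>adj_graph V R \<restriction> D\<^esub> v \<longleftrightarrow> u \<in> V \<inter> D \<and> v \<in> V \<inter> D \<and> R u v"
  by (auto simp: arcs_ends_conv)

lemma wf_digraph_adj_graph: "wf_digraph (adj_graph V R)"
  by unfold_locales auto

lemma simple_graph_int_product: "simple_graph (int_set_graph S \<times>\<^sub>K int_graph)"
  by (simp add: int_graph_def simple_graph_kronecker_product simple_graph_int_set_graph)

lemma int_product_eq_adj_graph:
  "int_set_graph S \<times>\<^sub>K int_graph =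
    adj_graph (S \<times> UNIV) (\<lambda>(a, b) (a', b'). a \<in> S \<and> a' \<in> S \<and> \<bar>a - a'\<bar> = 1 \<and> \<bar>b - b'\<bar> = 1)"
  by (simp add: kronecker_product_def int_graph_def int_set_graph_def)

lemma int_product_adj_iff:
  "(a, b) \<rightarrow>\<^bsub>int_set_graph S \<times>\<^sub>K int_graph\<^esub> (a', b') \<longleftrightarrow>
    a \<in> S \<and> a' \<in> S \<and> \<bar>a - a'\<bar> = 1 \<and> \<bar>b - b'\<bar> = 1"
  by (auto simp: int_product_eq_adj_graph)

text \<open>
  Along an edge both coordinates change by 1, so the parity of their sum never changes; a walk from
  the origin stays in the even part.
\<close>

lemma even_if_reachable:
  assumes "(0, 0) \<rightarrow>\<^sup>*\<^bsub>int_set_graph S \<times>\<^sub>K int_graph\<^esub> u"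
  shows "fst u \<in> S \<and> even (fst u + snd u)"
proof -
  interpret wf_digraph "int_set_graph S \<times>\<^sub>K int_graph"
    unfolding int_product_eq_adj_graph by (rule wf_digraph_adj_graph)
  show ?thesis
    using assms
  proof (induction rule: reachable_induct)
    case base
    then show ?case by (simp add: int_product_eq_adj_graph)
  next
    case (step u v)
    obtain a b a' b' where uv: "u = (a, b)" "v = (a', b')"
      by (cases u, cases v)
    have "a' \<in> S" "\<bar>a - a'\<bar> = 1" "\<bar>b - b'\<bar> = 1"
      using step.hyps by (simp_all add: uv int_product_adj_iff)
    moreover have "even (a + b)"
      using step.IH by (simp add: uv)
    ultimately show ?case
      unfolding uv fst_conv snd_conv by presburger
  qed
qed

text \<open>
  To reach \<open>(a, b)\<close>, first walk along the column of 0 to \<open>(0, b - a)\<close>, possible because \<open>b - a\<close> is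
  even, and then diagonally up to \<open>(a, b)\<close>. The column walk uses only 0 and its neighbour 1 in the
  first coordinate; the diagonal walk passes through every integer between 0 and \<open>a\<close>, which is why
  \<open>S\<close> has to be an initial segment.
\<close>

lemma reachable_if_even:
  assumes "1 \<in> S" and initial: "\<And>a b. a \<in> S \<Longrightarrow> 0 \<le> b \<Longrightarrow> b \<le> a \<Longrightarrow> b \<in> S"
    and "a \<in> S" and "0 \<le> a" and "even (a + b)"
  shows "(0, 0) \<rightarrow>\<^sup>*\<^bsub>int_set_graph S \<times>\<^sub>K int_graph\<^esub> (a, b)"
proof -
  let ?G = "int_set_graph S \<times>\<^sub>K int_graph"
  interpret wf_digraph ?G
    unfolding int_product_eq_adj_graph by (rule wf_digraph_adj_graph)
  have "0 \<in> S"
    using initial[OF \<open>1 \<in> S\<close>, of 0] by simp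
  have zigzag: "(0, 2 * k) \<rightarrow>\<^bsub>?G\<^esub> (1, 2 * k + 1)" "(1, 2 * k + 1) \<rightarrow>\<^bsub>?G\<^esub> (0, 2 * (k + 1))"
    "(0, 2 * k) \<rightarrow>\<^bsub>?G\<^esub> (1, 2 * k - 1)" "(1, 2 * k - 1) \<rightarrow>\<^bsub>?G\<^esub> (0, 2 * (k - 1))" for k
    using \<open>0 \<in> S\<close> \<open>1 \<in> S\<close> by (simp_all add: int_product_adj_iff)
  have column: "(0, 0) \<rightarrow>\<^sup>*\<^bsub>?G\<^esub> (0, 2 * k)" for k
  proof (induction k rule: int_induct[where k = 0])
    case base
    show ?case
      using \<open>0 \<in> S\<close> reachable_refl[of "(0, 0)"] by (simp add: int_product_eq_adj_graph)
  next
    case (step1 k)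
    then show ?case
      using zigzag(1,2) by (blast intro: reachable_adj_trans)
  next
    case (step2 k)
    then show ?case
      using zigzag(3,4) by (blast intro: reachable_adj_trans)
  qed
  have diagonal: "c \<in> S \<Longrightarrow> (0, 0) \<rightarrow>\<^sup>*\<^bsub>?G\<^esub> (c, 2 * k + c)" if "0 \<le> c" for c k
    using that
  proof (induction c rule: int_ge_induct)
    case base
    show ?case using column[of k] by simp
  next
    case (step c)
    have "c \<in> S"
      using initial[OF step.prems, of c] step.hyps by simp
    then have "(c, 2 * k + c) \<rightarrow>\<^bsub>?G\<^esub> (c + 1, 2 * k + (c + 1))"
      using step.prems by (simp add: int_product_adj_iff)
    then show ?case
      using step.IH[OF \<open>c \<in> S\<close>] by (rule reachable_adj_trans[rotated])
  qed
  have "2 * ((b - a) div 2) + a = b"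
    using \<open>even (a + b)\<close> by presburger
  then show ?thesis
    using diagonal[OF \<open>0 \<le> a\<close> \<open>a \<in> S\<close>, of "(b - a) div 2"] by simp
qed

text \<open>
  The inverse \<open>(a, b) \<mapsto> ((a + b) / 2, (b - a) / 2)\<close> is integral exactly on the pairs of even sum.
\<close>

lemma bij_betw_rotation:
  "bij_betw (\<lambda>(x, y). (x - y, x + y)) {(x, y). x - y \<in> S} {(a, b). a \<in> S \<and> even (a + b :: int)}"
proof -
  have halves: "(a + b) div 2 - (b - a) div 2 = a" "(a + b) div 2 + (b - a) div 2 = b"
    if "even (a + b)" for a b :: int
    using that by presburger+
  show ?thesis
    by (rule bij_betw_byWitness[where f' = "\<lambda>(a, b). ((a + b) div 2, (b - a) div 2)"])
      (auto simp: halves simp del: even_add)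
qed

lemma rotation_adj_iff:
  fixes x y x' y' :: int
  shows "((x' = x + 1 \<or> x' = x - 1) \<and> y' = y \<or> x' = x \<and> (y' = y + 1 \<or> y' = y - 1)) \<longleftrightarrow>
    \<bar>(x - y) - (x' - y')\<bar> = 1 \<and> \<bar>(x + y) - (x' + y')\<bar> = 1"
  by presburger

text \<open>
  Taking \<open>S\<close> to be a general initial segment treats the strip and the half-plane at once, since
  both regions have the form \<open>x - y \<in> S\<close>.
\<close>

lemma strip_iso_component:
  fixes S :: "int set"
  assumes "1 \<in> S" and "S \<subseteq> {0..}"
    and initial: "\<And>a b. a \<in> S \<Longrightarrow> 0 \<le> b \<Longrightarrow> b \<le> a \<Longrightarrow> b \<in> S"
  shows "digraph_iso (L {(x, y). x - y \<in> S}) (component (int_set_graph S \<times>\<^sub>K int_graph) (0, 0))"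
proof -
  let ?G = "int_set_graph S \<times>\<^sub>K int_graph" and ?D = "{(x, y). x - y \<in> S}"
    and ?f = "\<lambda>(x, y). (x - y, x + y) :: int \<times> int"
  interpret G: wf_digraph ?G
    unfolding int_product_eq_adj_graph by (rule wf_digraph_adj_graph)
  interpret Z: wf_digraph square_lattice
    unfolding square_lattice_def by (rule wf_digraph_adj_graph)
  have "(0, 0) \<in> verts ?G"
    using initial[OF \<open>1 \<in> S\<close>, of 0] by (simp add: int_product_eq_adj_graph)
  then have "verts (component ?G (0, 0)) = {u. (0, 0) \<rightarrow>\<^sup>*\<^bsub>?G\<^esub> u}"
    by (rule component_in_sccs(3)[OF simple_graph_int_product])
  also have "\<dots> = {(a, b). a \<in> S \<and> even (a + b)}"
  proof (intro equalityI subsetI)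
    fix u assume "u \<in> {u. (0, 0) \<rightarrow>\<^sup>*\<^bsub>?G\<^esub> u}"
    then show "u \<in> {(a, b). a \<in> S \<and> even (a + b)}"
      using even_if_reachable[of S u] by (simp add: case_prod_beta)
  next
    fix u assume "u \<in> {(a, b). a \<in> S \<and> even (a + b)}"
    then obtain a b where u: "u = (a, b)" "a \<in> S" "even (a + b)"
      by blast
    then have "0 \<le> a"
      using \<open>S \<subseteq> {0..}\<close> by auto
    then show "u \<in> {u. (0, 0) \<rightarrow>\<^sup>*\<^bsub>?G\<^esub> u}"
      unfolding u(1) mem_Collect_eq
      using u(2,3) by (intro reachable_if_even[OF \<open>1 \<in> S\<close> initial])
  qed
  finally have verts_C: "verts (component ?G (0, 0)) = {(a, b). a \<in> S \<and> even (a + b)}" .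
  then have scc: "pre_digraph.scc_of ?G (0, 0) = {(a, b). a \<in> S \<and> even (a + b)}"
    by (simp add: component_def)
  have adj_C: "(a, b) \<rightarrow>\<^bsub>component ?G (0, 0)\<^esub> (a', b') \<longleftrightarrow>
      a \<in> S \<and> a' \<in> S \<and> even (a + b) \<and> even (a' + b') \<and> \<bar>a - a'\<bar> = 1 \<and> \<bar>b - b'\<bar> = 1"
    for a b a' b'
    unfolding component_def scc
    unfolding int_product_eq_adj_graph adj_induce_subgraph_iff by auto
  have adj_L: "(x, y) \<rightarrow>\<^bsub>L ?D\<^esub> (x', y') \<longleftrightarrow> x - y \<in> S \<and> x' - y' \<in> S \<and>
      \<bar>(x - y) - (x' - y')\<bar> = 1 \<and> \<bar>(x + y) - (x' + y')\<bar> = 1" for x y x' y'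
    unfolding L_def square_lattice_def adj_induce_subgraph_iff
    using rotation_adj_iff[of x' x y' y] by simp
  have "bij_betw ?f (verts (L ?D)) (verts (component ?G (0, 0)))"
    unfolding verts_C using bij_betw_rotation by (simp add: L_def)
  moreover have "u \<rightarrow>\<^bsub>L ?D\<^esub> v \<longleftrightarrow> ?f u \<rightarrow>\<^bsub>component ?G (0, 0)\<^esub> ?f v" for u v
    by (cases u; cases v) (simp add: adj_L adj_C)
  moreover have "wf_digraph (L ?D)" "tail (L ?D) = fst" "head (L ?D) = snd"
    by (simp_all add: L_def Z.wellformed_induce_subgraph) (simp_all add: square_lattice_def)
  moreover have "wf_digraph (component ?G (0, 0))"
    "tail (component ?G (0, 0)) = fst" "head (component ?G (0, 0)) = snd"
    by (simp_all add: component_def G.wellformed_induce_subgraph)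
      (simp_all add: int_product_eq_adj_graph)
  ultimately show ?thesis
    by (subst digraph_iso_iff_bij) (assumption | intro exI[of _ ?f] conjI ballI)+
qed

theorem theorem4p3:
  shows "(\<forall>n::int. n \<ge> 2 \<longrightarrow>
            digraph_iso (L {(x, y). x \<ge> y \<and> y \<ge> x - (n - 1)})
                        (component (path_graph n \<times>\<^sub>K int_graph) (0, 0))) \<and>
         digraph_iso (L {(x, y). x \<ge> y})
                     (component (nonneg_graph \<times>\<^sub>K int_graph) (0, 0))"
proof (intro conjI allI impI)
  fix n :: int
  assume "n \<ge> 2"
  then have "digraph_iso (L {(x, y). x - y \<in> {0..n - 1}})
      (component (int_set_graph {0..n - 1} \<times>\<^sub>K int_graph) (0, 0))"
    by (intro strip_iso_component) auto
  moreover have "{(x, y). x - y \<in> {0..n - 1}} = {(x, y). x \<ge> y \<and> y \<ge> x - (n - 1)}"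
    by auto
  ultimately show "digraph_iso (L {(x, y). x \<ge> y \<and> y \<ge> x - (n - 1)})
      (component (path_graph n \<times>\<^sub>K int_graph) (0, 0))"
    by (simp add: path_graph_def)
next
  have "digraph_iso (L {(x, y). x - y \<in> {0..}})
      (component (int_set_graph {0..} \<times>\<^sub>K int_graph) (0, 0))"
    by (intro strip_iso_component) auto
  then show "digraph_iso (L {(x, y). x \<ge> y}) (component (nonneg_graph \<times>\<^sub>K int_graph) (0, 0))"
    by (simp add: nonneg_graph_def)
qed

end
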